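(* Let $n\ge 4$ be an integer. Let $S$ be an inverse-closed subset of $\mathbb{Z}_n\setminus\{0\}$ such that $\langle S\rangle=\mathbb{Z}_n$ and $n=p|S|$ for some prime $p$. Let $H=\{g\in\mathbb{Z}_n: S+g=S\}$ be the subgroup of periods of $S$ in $\mathbb{Z}_n$ and set $k=|S|/|H|$. Then $\mathrm{Cay}(\mathbb{Z}_n,S)$ admits a total perfect code if and only if $p=2$ and $s\not\equiv s'\pmod k$ for distinct $H+s,H+s'\in S/H$. Moreover, under this condition the total perfect codes in $\mathrm{Cay}(\mathbb{Z}_n,S)$ are precisely the subsets of $\mathbb{Z}_n$ of the form $\{a_0+i,\,a_1+k+i\}$ for $a_0,a_1\in H$ and $0\le i\le k-1$.
   Context: Inverse-closed means $-S=S$. The Cayley graph $\mathrm{Cay}(\mathbb{Z}_n,S)$ has vertex set $\mathbb{Z}_n$, with $x,y$ adjacent iff $y-x\in S$. A total perfect code in a graph is a set $C$ of vertices such that every vertex of the graph (including those in $C$) is adjacent to exactly one vertex of $C$. $S/H=\{H+s:s\in S\}$ is the set of cosets of $H$ meeting $S$; the congruence condition modulo $k$ is independent of the choice of the coset representatives $s,s'$. *)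

theory Defs
  imports
    "HOL-Algebra.Elementary_Groups"
    "HOL-Number_Theory.Cong"
    "HOL-Computational_Algebra.Primes"
    "Graph_Theory.Pair_Digraph"
begin

text \<open>
  The cyclic group of order \<open>n > 0\<close> is \<^const>\<open>integer_mod_group\<close>, with carrier \<open>{0..<int n}\<close>
  and addition modulo \<open>n\<close>, written multiplicatively.  Simple graphs are symmetric loop-free
  digraphs, i.e. \<^locale>\<open>pair_graph\<close>.
\<close>

definition inverse_closed :: "('a, 'b) monoid_scheme \<Rightarrow> 'a set \<Rightarrow> bool" where
  "inverse_closed G S \<longleftrightarrow> m_inv G ` S = S"

definition cayley_graph :: "('a, 'b) monoid_scheme \<Rightarrow> 'a set \<Rightarrow> 'a pair_pre_digraph" where
  "cayley_graph G S =
    \<lparr>pverts = carrier G,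
     parcs = {(x, y). x \<in> carrier G \<and> y \<in> carrier G \<and> y \<otimes>\<^bsub>G\<^esub> inv\<^bsub>G\<^esub> x \<in> S}\<rparr>"

definition total_perfect_code :: "'a pair_pre_digraph \<Rightarrow> 'a set \<Rightarrow> bool" where
  "total_perfect_code \<Gamma> C \<longleftrightarrow>
    C \<subseteq> pverts \<Gamma> \<and> (\<forall>v \<in> pverts \<Gamma>. \<exists>!c. c \<in> C \<and> v \<rightarrow>\<^bsub>with_proj \<Gamma>\<^esub> c)"

definition periods :: "('a, 'b) monoid_scheme \<Rightarrow> 'a set \<Rightarrow> 'a set" where
  "periods G S = {g \<in> carrier G. S #>\<^bsub>G\<^esub> g = S}"

lemma (in group) pair_graph_cayley_graph:
  assumes "finite (carrier G)" "S \<subseteq> carrier G - {\<one>}" "inverse_closed G S"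
  shows "pair_graph (cayley_graph G S)"
proof -
  let ?\<Gamma> = "cayley_graph G S"
  have arc: "(x, y) \<in> parcs ?\<Gamma> \<longleftrightarrow> x \<in> carrier G \<and> y \<in> carrier G \<and> y \<otimes> inv x \<in> S" for x y
    by (simp add: cayley_graph_def)
  have verts: "pverts ?\<Gamma> = carrier G"
    by (simp add: cayley_graph_def)
  have sym: "(y, x) \<in> parcs ?\<Gamma>" if "(x, y) \<in> parcs ?\<Gamma>" for x y
  proof -
    have xy: "x \<in> carrier G" "y \<in> carrier G" "y \<otimes> inv x \<in> S"
      using that arc by blast+
    then have "inv (y \<otimes> inv x) \<in> S"
      using assms(3) unfolding inverse_closed_def by blast
    with xy(1,2) have "x \<otimes> inv y \<in> S" by (simp add: inv_mult_group)
    with xy(1,2) show ?thesis using arc by blast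
  qed
  show ?thesis
  proof
    show "fst e \<in> pverts ?\<Gamma>" if "e \<in> parcs ?\<Gamma>" for e
      using that arc verts by (cases e) simp
    show "snd e \<in> pverts ?\<Gamma>" if "e \<in> parcs ?\<Gamma>" for e
      using that arc verts by (cases e) simp
    show "finite (pverts ?\<Gamma>)" using assms(1) verts by simp
    have "parcs ?\<Gamma> \<subseteq> carrier G \<times> carrier G" using arc by (intro subrelI) simp
    then show "finite (parcs ?\<Gamma>)" by (rule finite_subset) (simp add: assms(1))
    show "fst e \<noteq> snd e" if "e \<in> parcs ?\<Gamma>" for e
    proof
      assume "fst e = snd e"
      then have "fst e \<otimes> inv fst e \<in> S" "fst e \<in> carrier G"
        using that arc by (cases e; simp)+
      then show False using assms(2) by auto
    qed
    show "symmetric (with_proj ?\<Gamma>)"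
      unfolding symmetric_def arcs_ends_conv using sym by (intro symI) (simp add: with_proj_def)
  qed
qed

lemma (in group) subgroup_periods:
  assumes "S \<subseteq> carrier G"
  shows "subgroup (periods G S) G"
proof
  show "periods G S \<subseteq> carrier G" by (auto simp: periods_def)
  show "\<one> \<in> periods G S" using assms by (simp add: periods_def)
  show "x \<otimes> y \<in> periods G S" if "x \<in> periods G S" "y \<in> periods G S" for x y
    using that assms coset_mult_assoc[of S x y] unfolding periods_def by auto
  show "inv x \<in> periods G S" if "x \<in> periods G S" for x
  proof -
    have x: "x \<in> carrier G" "S #> x = S" using that by (auto simp: periods_def)
    then have "S #> inv x = S #> x #> inv x" by simp
    also have "\<dots> = S" using assms x(1) by (simp add: coset_mult_assoc)
    finally show ?thesis using x(1) by (simp add: periods_def)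
  qed
qed

text \<open>
  The order of the subgroup of periods divides \<open>card S\<close>, so the natural-number quotient
  \<open>card S div card (periods G S)\<close> is exact.
\<close>

lemma (in comm_group) card_eq_card_periods_times:
  assumes "finite S" "S \<subseteq> carrier G"
  defines "H \<equiv> periods G S"
  shows "card S = card H * card ((#>) H ` S)"
proof -
  interpret H: subgroup H G
    unfolding H_def by (rule subgroup_periods) fact
  let ?Q = "(#>) H ` S"
  have Q: "?Q \<subseteq> rcosets H"
    using assms(2) rcosetsI[OF H.subset] by (intro image_subsetI) (simp add: subset_iff)
  have "\<Union>?Q = S"
  proof
    show "S \<subseteq> \<Union>?Q"
    proof
      fix x assume "x \<in> S"
      then have "x \<in> H #> x" using rcos_self[OF _ H.subgroup_axioms] assms(2) by blast
      with \<open>x \<in> S\<close> show "x \<in> \<Union>?Q" by blast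
    qed
    show "\<Union>?Q \<subseteq> S"
    proof
      fix x assume "x \<in> \<Union>?Q"
      then obtain s where s: "s \<in> S" "x \<in> H #> s" by (elim UN_E)
      from s(2) obtain h where h: "h \<in> H" "x = h \<otimes> s"
        unfolding r_coset_def by (elim UN_E singletonE)
      have "x = s \<otimes> h"
        using h(2) m_comm[OF H.mem_carrier[OF h(1)], of s] assms(2) s(1) by (simp add: subset_iff)
      moreover have "s \<otimes> h \<in> S #> h"
        using rcosI[of s S h] assms(2) H.mem_carrier[OF h(1)] s(1) by blast
      moreover have "S #> h = S" using h(1) unfolding H_def periods_def by blast
      ultimately show "x \<in> S" by metis
    qed
  qed
  moreover have "card H * card ?Q = card (\<Union>?Q)"
  proof (rule card_partition)
    show "finite ?Q" using assms(1) by simp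
    show "finite (\<Union>?Q)" using \<open>\<Union>?Q = S\<close> assms(1) by simp
    show "card c = card H" if "c \<in> ?Q" for c
      using card_rcosets_equal[OF _ H.subset] Q that by (metis subsetD)
    show "c1 \<inter> c2 = {}" if "c1 \<in> ?Q" "c2 \<in> ?Q" "c1 \<noteq> c2" for c1 c2
      using rcos_disjoint[OF H.subgroup_axioms] Q that
      unfolding pairwise_def disjnt_def by blast
  qed
  ultimately show ?thesis by simp
qed

end

theory Submission
  imports Defs "HOL-Algebra.Multiplicative_Group"
begin

text \<open>
  A total perfect code \<open>C\<close> in a Cayley graph of a finite group is a tiling complement of \<open>S\<close>: each
  vertex \<open>v\<close> is uniquely of the form \<open>s\<inverse> c\<close>, so \<open>|C| |S| = n\<close> and hence \<open>|C| = p\<close>.  On the other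
  hand the unique neighbours inside \<open>C\<close> of the vertices of \<open>C\<close> match \<open>C\<close> perfectly, so \<open>|C|\<close> is even.
  The only even prime is \<open>2\<close>, and this is what forces \<open>p = 2\<close>.

  A pair \<open>{c\<^sub>0, c\<^sub>1}\<close> is a total perfect code exactly when translation by \<open>d = c\<^sub>1 - c\<^sub>0\<close> interchanges
  \<open>S\<close> and its complement.  Then \<open>2d\<close> is a period of \<open>S\<close> and \<open>d\<close> is not.  As \<open>n = 2k|H|\<close>, the
  subgroup \<open>H\<close> of the cyclic group consists of the multiples of \<open>2k\<close>, so \<open>d\<close> is congruent to \<open>k\<close>
  modulo \<open>2k\<close>; and all such \<open>d\<close> behave alike, since they differ by periods.  So codes exist if and
  only if translation by \<open>k\<close> interchanges \<open>S\<close> and its complement, and then the codes are the pairs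
  with difference in \<open>H + k\<close>.  Finally, two elements of \<open>S\<close> that are congruent modulo \<open>k\<close> but lie in
  different cosets of \<open>H\<close> differ by an element of \<open>H + k\<close>; so the congruence condition says that
  \<open>S\<close> and \<open>S + k\<close> are disjoint, and because \<open>2|S| = n\<close> they are then complementary.
\<close>

section \<open>Counting total perfect codes\<close>

text \<open>Mapping each element of the code to its unique neighbour in the code is an involution
  without fixed points, so its orbits partition the code into pairs.\<close>

lemma (in pair_graph) even_card_total_perfect_code:
  assumes C: "total_perfect_code G C"
  shows "even (card C)"
proof -
  have CV: "C \<subseteq> pverts G" and ex1: "\<And>v. v \<in> pverts G \<Longrightarrow> \<exists>!c. c \<in> C \<and> (v, c) \<in> parcs G"
    using C unfolding total_perfect_code_def by auto
  define f where "f c = (THE d. d \<in> C \<and> (c, d) \<in> parcs G)" for c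
  have f: "f c \<in> C" "(c, f c) \<in> parcs G" if "c \<in> C" for c
    using theI'[OF ex1[of c]] that CV unfolding f_def by blast+
  have f_eq: "f c = d" if "c \<in> C" "d \<in> C" "(c, d) \<in> parcs G" for c d
    unfolding f_def using ex1[of c] that CV by (intro the1_equality) blast+
  have ff: "f (f c) = c" if "c \<in> C" for c
    using f[OF that] that arcs_symmetric[of c "f c"] by (intro f_eq) auto
  have ne: "f c \<noteq> c" if "c \<in> C" for c
    using f(2)[OF that] no_loops by fastforce
  define P where "P = (\<lambda>c. {c, f c}) ` C"
  have U: "\<Union>P = C" unfolding P_def using f by auto
  have "finite C" using CV by (rule finite_subset) simp
  have "2 * card P = card (\<Union>P)"
  proof (rule card_partition)
    show "finite P" "finite (\<Union>P)" using \<open>finite C\<close> U by (auto simp: P_def)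
    show "card c = 2" if "c \<in> P" for c using that ne unfolding P_def by (fastforce simp: card_2_iff)
    show "c1 \<inter> c2 = {}" if "c1 \<in> P" "c2 \<in> P" "c1 \<noteq> c2" for c1 c2
    proof (rule ccontr)
      assume "c1 \<inter> c2 \<noteq> {}"
      then obtain z where "z \<in> c1" "z \<in> c2" by blast
      moreover have "c = {z, f z}" if "c \<in> P" "z \<in> c" for c
        using that ff unfolding P_def by fastforce
      ultimately show False using that by blast
    qed
  qed
  then show ?thesis using U by (metis dvd_triv_left)
qed

lemma (in group) total_perfect_code_cayley_graph_iff:
  "total_perfect_code (cayley_graph G S) C \<longleftrightarrow>
    C \<subseteq> carrier G \<and> (\<forall>v \<in> carrier G. \<exists>!c. c \<in> C \<and> c \<otimes> inv v \<in> S)"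
  unfolding total_perfect_code_def by (auto simp: cayley_graph_def subset_iff; metis)

text \<open>The code is a tiling complement: \<open>(s, c) \<mapsto> s\<inverse> c\<close> is a bijection onto the group.\<close>

lemma (in group) card_total_perfect_code:
  assumes S: "S \<subseteq> carrier G" and C: "total_perfect_code (cayley_graph G S) C"
  shows "card C * card S = order G"
proof -
  have CG: "C \<subseteq> carrier G" and ex1: "\<And>v. v \<in> carrier G \<Longrightarrow> \<exists>!c. c \<in> C \<and> c \<otimes> inv v \<in> S"
    using C by (auto simp: total_perfect_code_cayley_graph_iff)
  define f where "f = (\<lambda>(s, c). inv s \<otimes> c)"
  have quotient: "c \<otimes> inv (inv s \<otimes> c) = s" if "s \<in> S" "c \<in> C" for s c
  proof -
    have "s \<in> carrier G" "c \<in> carrier G" using that S CG by auto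
    then show ?thesis by (simp add: inv_mult_group flip: m_assoc)
  qed
  have "bij_betw f (S \<times> C) (carrier G)"
  proof (rule bij_betw_imageI)
    show "inj_on f (S \<times> C)"
    proof (rule inj_onI, clarsimp simp: f_def)
      fix s c s' c' assume *: "s \<in> S" "c \<in> C" "s' \<in> S" "c' \<in> C" "inv s \<otimes> c = inv s' \<otimes> c'"
      then have "inv s \<otimes> c \<in> carrier G" using S CG by auto
      from ex1[OF this] have "c = c'" using * quotient by metis
      moreover from this have "s = s'" using * quotient by metis
      ultimately show "s = s' \<and> c = c'" by simp
    qed
    show "f ` (S \<times> C) = carrier G"
    proof
      show "f ` (S \<times> C) \<subseteq> carrier G" using S CG by (auto simp: f_def)
      show "carrier G \<subseteq> f ` (S \<times> C)"
      proof
        fix v assume v: "v \<in> carrier G"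
        then obtain c where c: "c \<in> C" "c \<otimes> inv v \<in> S" using ex1 by blast
        have "v = inv (c \<otimes> inv v) \<otimes> c"
          using v c(1) CG by (simp add: inv_mult_group m_assoc subset_iff)
        then show "v \<in> f ` (S \<times> C)" using c unfolding f_def by force
      qed
    qed
  qed
  then have "card (S \<times> C) = order G" unfolding order_def by (rule bij_betw_same_card)
  then show ?thesis by (simp add: card_cartesian_product mult.commute)
qed

section \<open>Complementing shifts\<close>

definition complementing_shift :: "('a, 'b) monoid_scheme \<Rightarrow> 'a set \<Rightarrow> 'a \<Rightarrow> bool" where
  "complementing_shift G S d \<longleftrightarrow> (\<forall>x \<in> carrier G. x \<otimes>\<^bsub>G\<^esub> d \<in> S \<longleftrightarrow> x \<notin> S)"

lemma (in group) mem_periods_iff: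
  assumes S: "S \<subseteq> carrier G" and g: "g \<in> carrier G"
  shows "g \<in> periods G S \<longleftrightarrow> (\<forall>x \<in> carrier G. x \<otimes> g \<in> S \<longleftrightarrow> x \<in> S)"
proof
  assume "g \<in> periods G S"
  then have *: "S #> g = S" by (simp add: periods_def)
  show "\<forall>x \<in> carrier G. x \<otimes> g \<in> S \<longleftrightarrow> x \<in> S"
  proof
    fix x assume x: "x \<in> carrier G"
    have "x \<otimes> g \<in> S #> g \<longleftrightarrow> x \<in> S"
      using x g S unfolding r_coset_def by (auto simp: subset_iff)
    with * show "x \<otimes> g \<in> S \<longleftrightarrow> x \<in> S" by simp
  qed
next
  assume *: "\<forall>x \<in> carrier G. x \<otimes> g \<in> S \<longleftrightarrow> x \<in> S"
  have "x \<in> S #> g" if "x \<in> S" for x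
  proof -
    have "x \<otimes> inv g \<otimes> g \<in> S \<longleftrightarrow> x \<otimes> inv g \<in> S" using * that g S by blast
    then have "x \<otimes> inv g \<in> S" using that g S by (simp add: m_assoc subset_iff)
    moreover have "x = x \<otimes> inv g \<otimes> g" using that g S by (simp add: m_assoc subset_iff)
    ultimately show ?thesis unfolding r_coset_def by blast
  qed
  then have "S #> g = S" using * S unfolding r_coset_def by auto
  with g show "g \<in> periods G S" by (simp add: periods_def)
qed

lemma (in group) complementing_shift_square_mem_periods:
  assumes "S \<subseteq> carrier G" "d \<in> carrier G" "complementing_shift G S d"
  shows "d \<otimes> d \<in> periods G S"
  using assms by (auto simp: mem_periods_iff complementing_shift_def simp flip: m_assoc)

lemma (in group) complementing_shift_not_mem_periods:
  assumes "S \<subseteq> carrier G" "d \<in> carrier G" "complementing_shift G S d"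
  shows "d \<notin> periods G S"
  using assms one_closed unfolding complementing_shift_def by (metis mem_periods_iff)

lemma (in group) complementing_shift_mult_period:
  assumes "S \<subseteq> carrier G" "d \<in> carrier G" "complementing_shift G S d" "h \<in> periods G S"
  shows "complementing_shift G S (d \<otimes> h)"
proof -
  have h: "h \<in> carrier G" using assms(4) by (simp add: periods_def)
  with assms show ?thesis
    by (auto simp: mem_periods_iff complementing_shift_def simp flip: m_assoc)
qed

text \<open>If \<open>S\<close> is half of the group, a translate of \<open>S\<close> that is disjoint from \<open>S\<close> fills the whole
  complement.\<close>

lemma (in group) complementing_shift_if_disjoint:
  assumes fin: "finite (carrier G)" and S: "S \<subseteq> carrier G" and half: "order G = 2 * card S"
    and d: "d \<in> carrier G" and disj: "\<And>s. s \<in> S \<Longrightarrow> s \<otimes> d \<notin> S"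
  shows "complementing_shift G S d"
proof -
  define T where "T = {x \<in> carrier G. x \<otimes> d \<in> S}"
  have "bij_betw (\<lambda>x. x \<otimes> d) T S"
  proof (rule bij_betw_byWitness[where f' = "\<lambda>x. x \<otimes> inv d"])
  qed (use S d in \<open>auto simp: T_def m_assoc subset_iff\<close>)
  then have "card T = card S" by (rule bij_betw_same_card)
  moreover have "S \<inter> T = {}" using disj by (auto simp: T_def)
  moreover have "finite S" "finite T" using fin S by (auto simp: T_def intro: finite_subset)
  ultimately have "card (S \<union> T) = card (carrier G)"
    using half by (simp add: card_Un_disjoint order_def)
  moreover have "S \<union> T \<subseteq> carrier G" using S by (auto simp: T_def)
  ultimately have "S \<union> T = carrier G" using fin by (metis card_subset_eq)
  then show ?thesis using disj unfolding complementing_shift_def T_def by auto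
qed

text \<open>Writing a vertex as \<open>v = c\<^sub>0 x\<inverse>\<close>, the elements \<open>c\<^sub>0\<close> and \<open>c\<^sub>1\<close> of the code are neighbours of \<open>v\<close>
  when \<open>x\<close> and \<open>x d\<close>, respectively, lie in \<open>S\<close>; exactly one of the two must happen.\<close>

lemma (in comm_group) total_perfect_code_pair_iff:
  assumes S: "S \<subseteq> carrier G" and c: "c0 \<in> carrier G" "c1 \<in> carrier G" "c0 \<noteq> c1"
  shows "total_perfect_code (cayley_graph G S) {c0, c1} \<longleftrightarrow>
    complementing_shift G S (c1 \<otimes> inv c0)"
proof -
  have "(\<exists>!c. c \<in> {c0, c1} \<and> c \<otimes> inv v \<in> S) \<longleftrightarrow>
      (c0 \<otimes> inv v \<in> S \<longleftrightarrow> c1 \<otimes> inv v \<notin> S)" for v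
    using c(3) by auto
  then have "total_perfect_code (cayley_graph G S) {c0, c1} \<longleftrightarrow>
      (\<forall>v \<in> carrier G. c1 \<otimes> inv v \<in> S \<longleftrightarrow> c0 \<otimes> inv v \<notin> S)"
    using c by (auto simp: total_perfect_code_cayley_graph_iff)
  also have "\<dots> \<longleftrightarrow> complementing_shift G S (c1 \<otimes> inv c0)"
  proof
    assume *: "\<forall>v \<in> carrier G. c1 \<otimes> inv v \<in> S \<longleftrightarrow> c0 \<otimes> inv v \<notin> S"
    show "complementing_shift G S (c1 \<otimes> inv c0)"
      unfolding complementing_shift_def
    proof
      fix x assume x: "x \<in> carrier G"
      have "c1 \<otimes> inv (c0 \<otimes> inv x) = x \<otimes> (c1 \<otimes> inv c0)" "c0 \<otimes> inv (c0 \<otimes> inv x) = x"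
        using x c by (simp_all add: inv_mult m_lcomm[of _ x] m_comm[of c0])
      then show "x \<otimes> (c1 \<otimes> inv c0) \<in> S \<longleftrightarrow> x \<notin> S" using * x c by (metis inv_closed m_closed)
    qed
  next
    assume *: "complementing_shift G S (c1 \<otimes> inv c0)"
    show "\<forall>v \<in> carrier G. c1 \<otimes> inv v \<in> S \<longleftrightarrow> c0 \<otimes> inv v \<notin> S"
    proof
      fix v assume v: "v \<in> carrier G"
      have "c0 \<otimes> inv v \<otimes> (c1 \<otimes> inv c0) = c1 \<otimes> inv v \<otimes> (c0 \<otimes> inv c0)"
        using v c by (simp only: m_ac m_closed inv_closed)
      then have "c0 \<otimes> inv v \<otimes> (c1 \<otimes> inv c0) = c1 \<otimes> inv v" using v c by simp
      with * v c show "c1 \<otimes> inv v \<in> S \<longleftrightarrow> c0 \<otimes> inv v \<notin> S"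
        unfolding complementing_shift_def by (metis inv_closed m_closed)
    qed
  qed
  finally show ?thesis .
qed

section \<open>Cyclic groups\<close>

text \<open>By Lagrange, an element \<open>h\<close> of a subgroup of order \<open>m\<close> satisfies \<open>m h = 0\<close>, so it is a multiple
  of \<open>n / m\<close>; and there are only \<open>m\<close> such multiples.\<close>

lemma subgroup_integer_mod_group_eq:
  assumes n: "n = q * card H" "n > 0" and H: "subgroup H (integer_mod_group n)"
  shows "H = {h \<in> carrier (integer_mod_group n). int q dvd h}"
proof -
  let ?Z = "integer_mod_group n"
  interpret group ?Z by simp
  let ?D = "{h \<in> carrier ?Z. int q dvd h}"
  have q: "q > 0" and m: "card H > 0" using n by auto
  have Zc: "carrier ?Z = {0..<int n}" using n(2) by (simp add: carrier_integer_mod_group)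
  have "H \<subseteq> ?D"
  proof
    fix h assume h: "h \<in> H"
    interpret HG: group "?Z\<lparr>carrier := H\<rparr>" using H by (rule subgroup.subgroup_is_group) simp
    have "h [^]\<^bsub>?Z\<lparr>carrier := H\<rparr>\<^esub> order (?Z\<lparr>carrier := H\<rparr>) = \<one>\<^bsub>?Z\<lparr>carrier := H\<rparr>\<^esub>"
      by (rule HG.pow_order_eq_1) (simp add: h)
    then have "h [^]\<^bsub>?Z\<^esub> card H = \<one>\<^bsub>?Z\<^esub>"
      by (simp add: order_def nat_pow_consistent[symmetric] del: pow_integer_mod_group)
    then have "int n dvd int (card H) * h" by (simp add: mod_eq_0_iff_dvd)
    then have "int q dvd h" using n(1) m by (simp add: mult.commute)
    then show "h \<in> ?D" using h subgroup.subset[OF H] by auto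
  qed
  moreover have "?D \<subseteq> (\<lambda>j. int q * int j) ` {..<card H}"
  proof
    fix h assume "h \<in> ?D"
    then obtain j where j: "h = int q * j" "0 \<le> h" "h < int n" by (auto simp: Zc dvd_def)
    then have "0 \<le> j" "j < int (card H)"
      using q n(1) by (auto simp: zero_le_mult_iff)
    then show "h \<in> (\<lambda>j. int q * int j) ` {..<card H}"
      using j by (intro image_eqI[where x = "nat j"]) auto
  qed
  moreover have "finite ?D"
    by (rule finite_subset[of _ "{0..<int n}"]) (auto simp: Zc)
  ultimately show ?thesis
    by (metis (no_types, lifting) card_image_le card_lessThan card_mono card_seteq finite_imageI
        finite_lessThan order_trans)
qed

section \<open>The codes in the cyclic case\<close>

text \<open>When \<open>n = 2|S|\<close>, the subgroup \<open>H\<close> has index \<open>2k\<close>, so membership in \<open>H\<close> and equality of its cosets become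
  congruences modulo \<open>2k\<close>.\<close>

context
  fixes n k :: nat and S H :: "int set" and Z :: "int monoid"
  assumes Z: "Z = integer_mod_group n"
    and n: "n = 2 * card S" "n > 0"
    and S: "S \<subseteq> carrier Z"
    and H: "H = periods Z S"
    and k: "k = card S div card H"
begin

interpretation comm_group Z
  unfolding Z by (rule abelian_integer_mod_group)

lemma carrier_Z: "carrier Z = {0..<int n}"
  using n by (simp add: Z carrier_integer_mod_group)

lemma card_S: "card S = k * card H"
proof -
  have "finite S" using S carrier_Z finite_subset by fastforce
  then have "card H dvd card S"
    using card_eq_card_periods_times[OF _ S] unfolding H by (metis dvd_triv_left)
  then show ?thesis by (simp add: k)
qed

lemma k_bounds: "0 < k" "k < n"
proof -
  have "0 < card S" "0 < card H" using n card_S by auto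
  then show "0 < k" using card_S by (metis mult_eq_0_iff neq0_conv)
  have "k \<le> card S" using k by simp
  then show "k < n" using n by simp
qed

lemma k_in_carrier: "int k \<in> carrier Z"
  using k_bounds by (simp add: carrier_Z)

lemma two_k_dvd_n: "2 * int k dvd int n"
  using n(1) card_S by simp

lemma mem_H_iff: "h \<in> H \<longleftrightarrow> h \<in> carrier Z \<and> 2 * int k dvd h"
proof -
  have "H = {h \<in> carrier (integer_mod_group n). int (2 * k) dvd h}"
    using n card_S subgroup_periods[OF S]
    by (intro subgroup_integer_mod_group_eq) (simp_all add: H Z)
  then show ?thesis by (auto simp: Z)
qed

lemma mod_n_mem_H_iff: "x mod int n \<in> H \<longleftrightarrow> 2 * int k dvd x"
  using n(2) two_k_dvd_n by (simp add: mem_H_iff carrier_Z dvd_mod_iff)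

lemma dvd_mod_n_diff_iff: "2 * int k dvd x mod int n - y \<longleftrightarrow> 2 * int k dvd x - y"
  using mod_mod_cancel[OF two_k_dvd_n, of x] by (simp flip: mod_eq_dvd_iff)

lemma rcos_H_eq_iff:
  assumes "x \<in> carrier Z" "y \<in> carrier Z"
  shows "H #>\<^bsub>Z\<^esub> x = H #>\<^bsub>Z\<^esub> y \<longleftrightarrow> 2 * int k dvd x - y"
proof -
  have sub: "subgroup H Z" unfolding H using S by (rule subgroup_periods)
  have "H #>\<^bsub>Z\<^esub> x = H #>\<^bsub>Z\<^esub> y \<longleftrightarrow> x \<in> H #>\<^bsub>Z\<^esub> y"
    using assms sub by (metis rcos_self repr_independence)
  also have "\<dots> \<longleftrightarrow> x \<otimes>\<^bsub>Z\<^esub> inv\<^bsub>Z\<^esub> y \<in> H"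
    using assms by (intro subgroup.rcos_module[OF sub]) (auto intro: is_group)
  also have "x \<otimes>\<^bsub>Z\<^esub> inv\<^bsub>Z\<^esub> y = (x - y) mod int n"
    using assms by (simp add: Z mod_add_right_eq)
  finally show ?thesis by (simp add: mod_n_mem_H_iff)
qed

text \<open>Being a non-period whose double is a period singles out the class of \<open>k\<close> modulo \<open>2k\<close>, which
  is \<open>H + k\<close>; and within a coset of \<open>H\<close> all elements shift \<open>S\<close> in the same way.\<close>

lemma complementing_shift_iff:
  assumes d: "d \<in> carrier Z"
  shows "complementing_shift Z S d \<longleftrightarrow>
    2 * int k dvd d - int k \<and> complementing_shift Z S (int k)"
proof -
  have shift: "complementing_shift Z S y"
    if "complementing_shift Z S x" "x \<in> carrier Z" "y \<in> carrier Z" "2 * int k dvd y - x" for x y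
  proof -
    have "(y - x) mod int n \<in> periods Z S"
      using that(4) mod_n_mem_H_iff by (simp add: H)
    from complementing_shift_mult_period[OF S that(2,1) this]
    show ?thesis using that(3) carrier_Z by (simp add: Z mod_add_right_eq)
  qed
  have "2 * int k dvd d - int k" if "complementing_shift Z S d"
  proof -
    have "(2 * d) mod int n \<in> H"
      using complementing_shift_square_mem_periods[OF S d that] by (simp add: H Z)
    then have "int k dvd d" by (simp add: mod_n_mem_H_iff)
    then obtain j where j: "d = int k * j" by (elim dvdE)
    have "\<not> 2 * int k dvd d"
      using complementing_shift_not_mem_periods[OF S d that] d by (simp add: mem_H_iff flip: H)
    then have "odd j" using j by (auto simp: mult.commute)
    then have "2 dvd j - 1" by simp
    then show ?thesis
      using j by (auto simp: dvd_def algebra_simps)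
  qed
  moreover have "2 * int k dvd int k - d \<longleftrightarrow> 2 * int k dvd d - int k"
    by (rule dvd_diff_commute)
  ultimately show ?thesis using shift d k_in_carrier by blast
qed

text \<open>Congruence modulo \<open>k\<close> merges the cosets of \<open>H\<close> in pairs \<open>H + s\<close>, \<open>H + s + k\<close>, and a
  complementing shift by \<open>k\<close> puts exactly one coset of each pair into \<open>S\<close>.  Conversely, if no pair lies
  in \<open>S\<close>, the translate of \<open>S\<close> by \<open>k\<close> is disjoint from \<open>S\<close>, and the cardinalities do the rest.\<close>

lemma complementing_shift_k_iff:
  "complementing_shift Z S (int k) \<longleftrightarrow>
    (\<forall>s\<in>S. \<forall>s'\<in>S. H #>\<^bsub>Z\<^esub> s \<noteq> H #>\<^bsub>Z\<^esub> s' \<longrightarrow> \<not> [s = s'] (mod int k))"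
    (is "_ \<longleftrightarrow> ?separated")
proof
  assume shift: "complementing_shift Z S (int k)"
  show ?separated
  proof (intro ballI impI notI)
    fix s s' assume *: "s \<in> S" "s' \<in> S" "H #>\<^bsub>Z\<^esub> s \<noteq> H #>\<^bsub>Z\<^esub> s'" "[s = s'] (mod int k)"
    then have s: "s \<in> carrier Z" "s' \<in> carrier Z" using S by auto
    obtain j where j: "s - s' = int k * j"
      using *(4) by (auto simp: cong_iff_dvd_diff)
    \<comment> \<open>An odd multiple of \<open>k\<close> is congruent to \<open>k\<close> modulo \<open>2k\<close>, so \<open>s\<close> is the shift of \<open>s'\<close> by a
      complementing element and cannot lie in \<open>S\<close> with it.\<close>
    have "odd j" using *(3) j s by (auto simp: rcos_H_eq_iff mult.commute)
    then have "2 dvd j - 1" by simp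
    then have "2 * int k dvd s - s' - int k" using j by (auto simp: dvd_def algebra_simps)
    then have "complementing_shift Z S ((s - s') mod int n)"
      using shift n(2) by (subst complementing_shift_iff) (simp_all add: carrier_Z dvd_mod_n_diff_iff)
    moreover have "s' \<otimes>\<^bsub>Z\<^esub> ((s - s') mod int n) = s"
      using s carrier_Z by (simp add: Z mod_add_right_eq)
    ultimately show False using s * unfolding complementing_shift_def by metis
  qed
next
  assume sep: ?separated
  show "complementing_shift Z S (int k)"
  proof (rule complementing_shift_if_disjoint[OF _ S _ k_in_carrier])
    show "finite (carrier Z)" "order Z = 2 * card S"
      using n by (simp_all add: carrier_Z order_def)
    show "s \<otimes>\<^bsub>Z\<^esub> int k \<notin> S" if s: "s \<in> S" for s
    proof
      let ?t = "s \<otimes>\<^bsub>Z\<^esub> int k"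
      assume t: "?t \<in> S"
      have eq: "?t = (s + int k) mod int n" by (simp add: Z)
      have diff: "2 * int k dvd ?t - s - int k"
        unfolding eq diff_diff_eq dvd_mod_n_diff_iff by simp
      then have "int k dvd ?t - s"
        using dvd_add[OF dvd_mult_right[OF diff] dvd_refl] by simp
      then have "[?t = s] (mod int k)" by (simp add: cong_iff_dvd_diff)
      moreover have "\<not> 2 * int k dvd ?t - s"
      proof
        assume "2 * int k dvd ?t - s"
        from dvd_diff[OF this diff] have "2 * int k dvd int k" by simp
        then show False using k_bounds by (simp add: zdvd_not_zless)
      qed
      then have "H #>\<^bsub>Z\<^esub> ?t \<noteq> H #>\<^bsub>Z\<^esub> s"
        using s t S by (subst rcos_H_eq_iff) auto
      ultimately show False using sep s t by blast
    qed
  qed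
qed

lemma total_perfect_code_pair_mod_iff:
  assumes "c0 \<in> carrier Z" "c1 \<in> carrier Z" "c0 \<noteq> c1"
  shows "total_perfect_code (cayley_graph Z S) {c0, c1} \<longleftrightarrow>
    2 * int k dvd c1 - c0 - int k \<and> complementing_shift Z S (int k)"
proof -
  have d: "c1 \<otimes>\<^bsub>Z\<^esub> inv\<^bsub>Z\<^esub> c0 = (c1 - c0) mod int n"
    using assms by (simp add: Z mod_add_right_eq)
  have "(c1 - c0) mod int n \<in> carrier Z" using n by (simp add: carrier_Z)
  then show ?thesis
    unfolding total_perfect_code_pair_iff[OF S assms] d
    by (simp add: complementing_shift_iff dvd_mod_n_diff_iff)
qed

lemma total_perfect_code_imp_pair:
  assumes "total_perfect_code (cayley_graph Z S) C"
  obtains c0 c1 where "C = {c0, c1}" "c0 \<noteq> c1" "c0 \<in> carrier Z" "c1 \<in> carrier Z"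
proof -
  have "card C * card S = 2 * card S"
    using card_total_perfect_code[OF S assms] n by (simp add: order_def carrier_Z)
  then have "card C = 2" using n by simp
  moreover have "C \<subseteq> carrier Z"
    using assms by (simp add: total_perfect_code_cayley_graph_iff)
  ultimately show thesis using that by (auto simp: card_2_iff)
qed

text \<open>A code is a pair with \<open>c\<^sub>1 - c\<^sub>0\<close> in \<open>H + k\<close>.  The residue \<open>i\<close> of \<open>c\<^sub>0\<close> modulo \<open>k\<close> leaves
  two possibilities for its coset, \<open>H + i\<close> and \<open>H + k + i\<close>, and \<open>c\<^sub>1\<close> then lies in the other one.\<close>

lemma total_perfect_codes_eq:
  assumes shift: "complementing_shift Z S (int k)"
  shows "{C. total_perfect_code (cayley_graph Z S) C} =
    {{a0 \<otimes>\<^bsub>Z\<^esub> i, a1 \<otimes>\<^bsub>Z\<^esub> int k \<otimes>\<^bsub>Z\<^esub> i} | a0 a1 i.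
       a0 \<in> H \<and> a1 \<in> H \<and> 0 \<le> i \<and> i \<le> int k - 1}" (is "?L = ?R")
proof (intro equalityI subsetI)
  fix C assume "C \<in> ?L"
  then have C: "total_perfect_code (cayley_graph Z S) C" by simp
  then obtain c0 c1 where c: "C = {c0, c1}" "c0 \<noteq> c1" "c0 \<in> carrier Z" "c1 \<in> carrier Z"
    by (rule total_perfect_code_imp_pair)
  have diff: "2 * int k dvd c1 - c0 - int k"
    using C c by (simp add: total_perfect_code_pair_mod_iff)
  have mem_R: "{x, y} \<in> ?R"
    if "x \<in> carrier Z" "y \<in> carrier Z" "0 \<le> i" "i \<le> int k - 1"
      "2 * int k dvd x - i" "2 * int k dvd y - int k - i" for x y i
  proof -
    have "x = ((x - i) mod int n) \<otimes>\<^bsub>Z\<^esub> i"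
      "y = ((y - int k - i) mod int n) \<otimes>\<^bsub>Z\<^esub> int k \<otimes>\<^bsub>Z\<^esub> i"
      using that(1,2) by (simp_all add: carrier_Z, simp_all add: Z mod_simps)
    moreover have "(x - i) mod int n \<in> H" "(y - int k - i) mod int n \<in> H"
      using that(5,6) by (simp_all add: mod_n_mem_H_iff)
    ultimately show ?thesis using that(3,4) by (intro CollectI exI conjI) (rule arg_cong2[where f = "\<lambda>u v. {u, v}"])
  qed
  define i where "i = c0 mod int k"
  have i: "0 \<le> i" "i \<le> int k - 1"
    using k_bounds by (simp_all add: i_def)
  obtain q where q: "c0 - i = int k * q"
    unfolding i_def by (metis minus_mod_eq_mult_div)
  \<comment> \<open>Which of the two elements plays the role of \<open>a\<^sub>0 + i\<close> depends on the parity of \<open>q\<close>.\<close>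
  show "C \<in> ?R"
  proof (cases "even q")
    case True
    then have "2 * int k dvd c0 - i" using q by (auto simp: dvd_def)
    moreover from dvd_add[OF diff this] have "2 * int k dvd c1 - int k - i"
      by (simp add: algebra_simps)
    ultimately show ?thesis using mem_R[OF c(3,4) i] c(1) by simp
  next
    case False
    then have "2 dvd q - 1" by simp
    then have *: "2 * int k dvd c0 - int k - i" using q by (auto simp: dvd_def algebra_simps)
    have "2 * int k dvd (c1 - c0 - int k) + (c0 - int k - i) + 2 * int k"
      using diff * by (intro dvd_add) auto
    then have "2 * int k dvd c1 - i" by (simp add: algebra_simps)
    with * show ?thesis using mem_R[OF c(4,3) i] c(1) by (simp add: insert_commute)
  qed
next
  fix C assume "C \<in> ?R"
  then obtain a0 a1 i where a: "C = {a0 \<otimes>\<^bsub>Z\<^esub> i, a1 \<otimes>\<^bsub>Z\<^esub> int k \<otimes>\<^bsub>Z\<^esub> i}" "a0 \<in> H" "a1 \<in> H"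
    by blast
  let ?x = "a0 \<otimes>\<^bsub>Z\<^esub> i" and ?y = "a1 \<otimes>\<^bsub>Z\<^esub> int k \<otimes>\<^bsub>Z\<^esub> i"
  have xy: "?x = (a0 + i) mod int n" "?y = (a1 + int k + i) mod int n"
    by (simp_all add: Z mod_simps)
  have "2 * int k dvd a1 - a0" using a(2,3) by (auto simp: mem_H_iff)
  moreover have "2 * int k dvd ?y - (a1 + int k + i)" "2 * int k dvd ?x - (a0 + i)"
    unfolding xy dvd_mod_n_diff_iff by simp_all
  ultimately have
    "2 * int k dvd (a1 - a0) + (?y - (a1 + int k + i)) - (?x - (a0 + i))"
    by (rule dvd_diff[OF dvd_add])
  then have diff: "2 * int k dvd ?y - ?x - int k" by (simp add: algebra_simps)
  moreover have "?x \<noteq> ?y"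
  proof
    assume "?x = ?y"
    with diff have "2 * int k dvd int k" by simp
    then show False using k_bounds by (simp add: zdvd_not_zless)
  qed
  moreover have "?x \<in> carrier Z" "?y \<in> carrier Z" unfolding xy using n by (simp_all add: carrier_Z)
  ultimately show "C \<in> ?L" using shift a(1) by (simp add: total_perfect_code_pair_mod_iff)
qed

lemma total_perfect_code_exists_iff:
  "(\<exists>C. total_perfect_code (cayley_graph Z S) C) \<longleftrightarrow> complementing_shift Z S (int k)"
proof
  assume "\<exists>C. total_perfect_code (cayley_graph Z S) C"
  then show "complementing_shift Z S (int k)"
    by (metis total_perfect_code_imp_pair total_perfect_code_pair_mod_iff)
next
  assume "complementing_shift Z S (int k)"
  moreover have "int k \<noteq> 0" "0 \<in> carrier Z" using k_bounds n by (simp_all add: carrier_Z)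
  ultimately have "total_perfect_code (cayley_graph Z S) {0, int k}"
    using k_in_carrier by (simp add: total_perfect_code_pair_mod_iff)
  then show "\<exists>C. total_perfect_code (cayley_graph Z S) C" ..
qed

end

theorem theorem5p3:
  fixes n p k :: nat and S H :: "int set" and Z :: "int monoid"
  assumes "n \<ge> 4"
    and "Z = integer_mod_group n"
    and "S \<subseteq> carrier Z - {\<one>\<^bsub>Z\<^esub>}"
    and "inverse_closed Z S"
    and "generate Z S = carrier Z"
    and "prime p"
    and "n = p * card S"
    and "H = periods Z S"
    and "k = card S div card H"
  shows "((\<exists>C. total_perfect_code (cayley_graph Z S) C) \<longleftrightarrow>
            p = 2 \<and> (\<forall>s\<in>S. \<forall>s'\<in>S. H #>\<^bsub>Z\<^esub> s \<noteq> H #>\<^bsub>Z\<^esub> s' \<longrightarrow> \<not> [s = s'] (mod int k))) \<and>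
         (p = 2 \<and> (\<forall>s\<in>S. \<forall>s'\<in>S. H #>\<^bsub>Z\<^esub> s \<noteq> H #>\<^bsub>Z\<^esub> s' \<longrightarrow> \<not> [s = s'] (mod int k)) \<longrightarrow>
            {C. total_perfect_code (cayley_graph Z S) C} =
            {{a0 \<otimes>\<^bsub>Z\<^esub> i, a1 \<otimes>\<^bsub>Z\<^esub> int k \<otimes>\<^bsub>Z\<^esub> i} | a0 a1 i.
               a0 \<in> H \<and> a1 \<in> H \<and> 0 \<le> i \<and> i \<le> int k - 1})"
proof -
  let ?sep = "\<forall>s\<in>S. \<forall>s'\<in>S. H #>\<^bsub>Z\<^esub> s \<noteq> H #>\<^bsub>Z\<^esub> s' \<longrightarrow> \<not> [s = s'] (mod int k)"
  interpret comm_group Z unfolding assms(2) by (rule abelian_integer_mod_group)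
  have S: "S \<subseteq> carrier Z" using assms(3) by blast
  have Zc: "carrier Z = {0..<int n}" using assms(1,2) by (simp add: carrier_integer_mod_group)
  have cS: "card S > 0" using assms(1,7) by (cases "card S") auto
  have p2: "p = 2" if C: "total_perfect_code (cayley_graph Z S) C" for C
  proof -
    have "order Z = n" by (simp add: order_def Zc)
    then have "card C * card S = p * card S"
      using card_total_perfect_code[OF S C] assms(7) by metis
    then have "card C = p" using cS by simp
    moreover have "pair_graph (cayley_graph Z S)"
      using assms(3,4) by (intro pair_graph_cayley_graph) (simp_all add: Zc)
    then have "even (card C)" using C by (rule pair_graph.even_card_total_perfect_code)
    ultimately show ?thesis using primes_dvd_imp_eq[OF two_is_prime_nat assms(6)] by simp
  qed
  have "n > 0" using assms(1) by simp
  show ?thesis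
  proof (cases "p = 2")
    case True
    then have n: "n = 2 * card S" using assms(7) by simp
    note ctx = assms(2) n \<open>n > 0\<close> S assms(8,9)
    show ?thesis
      using True total_perfect_code_exists_iff[OF ctx] complementing_shift_k_iff[OF ctx]
        total_perfect_codes_eq[OF ctx] by simp
  next
    case False
    then show ?thesis using p2 by blast
  qed
qed

end
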